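(* Let $G=(V_G,E_G)$ be a finite connected multigraph without self-loops and with at least one edge, and let $H$ be a connected component of the edge-induced subgraph of $G$ consisting of the edges on which $\eta^*$ attains its minimum over $E_G$. Then $H$ is a solution to the densest subgraph problem: $\theta(H)=\max_{H'\in\mathcal{H}}\theta(H')$, where $\mathcal{H}$ is the set of all vertex-induced, connected subgraphs of $G$ that contain at least one edge.
   Context: For a graph with vertex set $V$ ($|V|\ge2$) and edge set $E$, the denseness is $\theta=\frac{|E|}{|V|-1}$. $\Gamma_G$ is the set of spanning trees of $G$ (as subsets of $E_G$), $\mathcal{P}(\Gamma_G)$ the set of probability mass functions (pmfs) on it. A pmf is optimal if it minimizes $\sum_{\gamma,\gamma'\in\Gamma_G}|\gamma\cap\gamma'|\,\mu(\gamma)\mu(\gamma')$ over $\mathcal{P}(\Gamma_G)$. The edge usage probabilities $\eta^*(e)=\sum_{\gamma\ni e}\mu^*(\gamma)$, $e\in E_G$, are the same for all optimal $\mu^*$. A subgraph with vertex set $V_H$ is vertex-induced if it contains every edge of $G$ with both endpoints in $V_H$; the component $H$ above is known to be vertex-induced and connected with at least one edge, so $H\in\mathcal{H}$. *)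

theory Defs
  imports "HOL-Probability.Probability_Mass_Function"
begin

section \<open>Undirected multigraphs\<close>

text \<open>Edges are abstract objects, so distinct edges may have the same endpoints. An edge is a
  self-loop if its endpoint set is a singleton. A subgraph keeps the endpoint function of the
  ambient graph, so that it is determined by its vertex and edge sets.\<close>

record ('v, 'e) multigraph =
  verts :: "'v set"
  edges :: "'e set"
  ends :: "'e \<Rightarrow> 'v set"

definition finite_multigraph :: "('v, 'e) multigraph \<Rightarrow> bool" where
  "finite_multigraph G \<longleftrightarrow> finite (verts G) \<and> finite (edges G) \<and>
     (\<forall>e\<in>edges G. ends G e \<subseteq> verts G \<and> card (ends G e) \<in> {1, 2})"

definition loopless :: "('v, 'e) multigraph \<Rightarrow> bool" where
  "loopless G \<longleftrightarrow> (\<forall>e\<in>edges G. card (ends G e) \<noteq> 1)"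

definition adj_rel :: "('v, 'e) multigraph \<Rightarrow> ('v \<times> 'v) set" where
  "adj_rel G = {(u, v). \<exists>e\<in>edges G. ends G e = {u, v}}"

definition connected_graph :: "('v, 'e) multigraph \<Rightarrow> bool" where
  "connected_graph G \<longleftrightarrow> verts G \<noteq> {} \<and> (\<forall>u\<in>verts G. \<forall>v\<in>verts G. (u, v) \<in> (adj_rel G)\<^sup>*)"

text \<open>A cycle visits the distinct vertices \<open>vs\<close> cyclically through the distinct edges \<open>es\<close>. Length 1
  is a self-loop and length 2 is a pair of parallel edges.\<close>

definition is_cycle :: "('v, 'e) multigraph \<Rightarrow> 'v list \<Rightarrow> 'e list \<Rightarrow> bool" where
  "is_cycle G vs es \<longleftrightarrow> es \<noteq> [] \<and> length vs = length es \<and> distinct vs \<and> distinct es \<and>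
     set es \<subseteq> edges G \<and>
     (\<forall>i<length es. ends G (es ! i) = {vs ! i, vs ! (Suc i mod length es)})"

definition is_tree :: "('v, 'e) multigraph \<Rightarrow> bool" where
  "is_tree G \<longleftrightarrow> connected_graph G \<and> (\<nexists>vs es. is_cycle G vs es)"

definition subgraph :: "('v, 'e) multigraph \<Rightarrow> ('v, 'e) multigraph \<Rightarrow> bool" where
  "subgraph H G \<longleftrightarrow> verts H \<subseteq> verts G \<and> edges H \<subseteq> edges G \<and> ends H = ends G \<and>
     (\<forall>e\<in>edges H. ends H e \<subseteq> verts H)"

definition vertex_induced :: "('v, 'e) multigraph \<Rightarrow> ('v, 'e) multigraph \<Rightarrow> bool" where
  "vertex_induced H G \<longleftrightarrow> subgraph H G \<and> (\<forall>e\<in>edges G. ends G e \<subseteq> verts H \<longrightarrow> e \<in> edges H)"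

definition edge_induced :: "('v, 'e) multigraph \<Rightarrow> 'e set \<Rightarrow> ('v, 'e) multigraph" where
  "edge_induced G F = \<lparr>verts = (\<Union>e\<in>F. ends G e), edges = F, ends = ends G\<rparr>"

definition connected_component_of_graph ::
    "('v, 'e) multigraph \<Rightarrow> ('v, 'e) multigraph \<Rightarrow> bool" where
  "connected_component_of_graph H G \<longleftrightarrow> subgraph H G \<and> connected_graph H \<and>
     (\<forall>H'. subgraph H' G \<and> connected_graph H' \<and> subgraph H H' \<longrightarrow> H' = H)"


section \<open>Optimal probability mass functions on spanning trees\<close>

definition spanning_trees :: "('v, 'e) multigraph \<Rightarrow> 'e set set" where
  "spanning_trees G = {\<gamma>. \<gamma> \<subseteq> edges G \<and> is_tree (G\<lparr>edges := \<gamma>\<rparr>)}"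

definition tree_pmfs :: "('v, 'e) multigraph \<Rightarrow> 'e set pmf set" where
  "tree_pmfs G = {\<mu>. set_pmf \<mu> \<subseteq> spanning_trees G}"

definition expected_overlap :: "('v, 'e) multigraph \<Rightarrow> 'e set pmf \<Rightarrow> real" where
  "expected_overlap G \<mu> =
     (\<Sum>\<gamma>\<in>spanning_trees G. \<Sum>\<gamma>'\<in>spanning_trees G. real (card (\<gamma> \<inter> \<gamma>')) * pmf \<mu> \<gamma> * pmf \<mu> \<gamma>')"

definition optimal_pmf :: "('v, 'e) multigraph \<Rightarrow> 'e set pmf \<Rightarrow> bool" where
  "optimal_pmf G \<mu> \<longleftrightarrow> \<mu> \<in> tree_pmfs G \<and>
     (\<forall>\<nu>\<in>tree_pmfs G. expected_overlap G \<mu> \<le> expected_overlap G \<nu>)"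

definition edge_usage :: "('v, 'e) multigraph \<Rightarrow> 'e set pmf \<Rightarrow> 'e \<Rightarrow> real" where
  "edge_usage G \<mu> e = (\<Sum>\<gamma> | \<gamma> \<in> spanning_trees G \<and> e \<in> \<gamma>. pmf \<mu> \<gamma>)"

definition min_usage_edges :: "('v, 'e) multigraph \<Rightarrow> 'e set pmf \<Rightarrow> 'e set" where
  "min_usage_edges G \<mu> = {e \<in> edges G. edge_usage G \<mu> e = Min (edge_usage G \<mu> ` edges G)}"


section \<open>The densest subgraph problem\<close>

definition denseness :: "('v, 'e) multigraph \<Rightarrow> real" where
  "denseness G = real (card (edges G)) / (real (card (verts G)) - 1)"

definition densest_candidates :: "('v, 'e) multigraph \<Rightarrow> ('v, 'e) multigraph set" where
  "densest_candidates G = {H. vertex_induced H G \<and> connected_graph H \<and> edges H \<noteq> {}}"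

lemma finite_densest_candidates:
  assumes "finite_multigraph G"
  shows "finite (densest_candidates G)"
proof (rule finite_subset)
  show "densest_candidates G \<subseteq>
      (\<lambda>(V, E). \<lparr>verts = V, edges = E, ends = ends G\<rparr>) ` (Pow (verts G) \<times> Pow (edges G))"
  proof
    fix H assume "H \<in> densest_candidates G"
    then have "subgraph H G"
      by (simp add: densest_candidates_def vertex_induced_def)
    then show "H \<in> (\<lambda>(V, E). \<lparr>verts = V, edges = E, ends = ends G\<rparr>) `
        (Pow (verts G) \<times> Pow (edges G))"
      by (intro image_eqI[of _ _ "(verts H, edges H)"]) (auto simp: subgraph_def)
  qed
  show "finite ((\<lambda>(V, E). \<lparr>verts = V, edges = E, ends = ends G\<rparr>) `
      (Pow (verts G) \<times> Pow (edges G)))"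
    using assms by (simp add: finite_multigraph_def)
qed

end

theory Submission
  imports Defs
begin

text \<open>Write \<open>\<eta>\<close> for the edge usage of the optimal pmf and \<open>m\<close> for its minimum. Exchanging the order
  of summation shows that the expected overlap of a pmf is the sum of the squares of its edge usages.
  Hence, if a spanning tree \<open>\<gamma>\<close> of positive mass could trade an edge \<open>f\<close> for an edge \<open>e\<close> with
  \<open>\<eta> e < \<eta> f\<close>, moving a little mass from \<open>\<gamma>\<close> to \<open>\<gamma> - f + e\<close> would lower the overlap: all trees in
  the support are minimum spanning trees for the weight \<open>\<eta>\<close> (\<open>optimal_pmf_no_improving_exchange\<close>).
  As in Kruskal's algorithm, such a tree joins the ends of each edge of usage \<open>m\<close> by a path of edges of
  usage \<open>m\<close> (\<open>support_tree_joins_min_usage_edge\<close>), and therefore it restricts to a spanning tree of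
  the component \<open>H\<close>.

  The rest is double counting. For a set \<open>F\<close> of edges, the sum of \<open>\<eta>\<close> over \<open>F\<close> is the expected
  number of edges that the random tree has in \<open>F\<close>. For \<open>F = edges H\<close> this number is always
  \<open>|V_H| - 1\<close>, so \<open>m |E_H| = |V_H| - 1\<close>; hence \<open>m > 0\<close> and the denseness of \<open>H\<close> is \<open>1/m\<close>. For any
  candidate \<open>H'\<close> the tree restricts to a forest with at most \<open>|V_H'| - 1\<close> edges, so
  \<open>m |E_H'| \<le> |V_H'| - 1\<close> and the denseness of \<open>H'\<close> is at most \<open>1/m\<close>.

  Finally, \<open>H\<close> is vertex-induced: an edge \<open>e\<close> of \<open>G\<close> outside \<open>H\<close> with both ends in \<open>H\<close> would close
  a cycle with the part in \<open>H\<close> of any tree of the support, so no such tree uses it and \<open>\<eta> e = 0\<close>;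
  then \<open>e\<close> has minimum usage after all, and belongs to \<open>H\<close>.\<close>

section \<open>Joined vertices and forests\<close>

definition joined :: "('e \<Rightarrow> 'v set) \<Rightarrow> 'e set \<Rightarrow> ('v \<times> 'v) set" where
  "joined en F = {(u, v). \<exists>e\<in>F. en e = {u, v}}\<^sup>*"

text \<open>Acyclicity in the form in which edge exchanges use it: each edge is a bridge. Self-loops are
  excluded because the empty path joins their end to itself.\<close>

definition forest :: "('e \<Rightarrow> 'v set) \<Rightarrow> 'e set \<Rightarrow> bool" where
  "forest en F \<longleftrightarrow> (\<forall>e\<in>F. \<forall>u v. en e = {u, v} \<longrightarrow> (u, v) \<notin> joined en (F - {e}))"

lemma connected_graph_iff_joined:
  "connected_graph G \<longleftrightarrow>
     verts G \<noteq> {} \<and> (\<forall>u\<in>verts G. \<forall>v\<in>verts G. (u, v) \<in> joined (ends G) (edges G))"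
  by (simp add: connected_graph_def joined_def adj_rel_def)

lemma joined_refl [simp]: "(u, u) \<in> joined en F"
  by (simp add: joined_def)

lemma joined_trans: "(u, v) \<in> joined en F \<Longrightarrow> (v, w) \<in> joined en F \<Longrightarrow> (u, w) \<in> joined en F"
  unfolding joined_def by (rule rtrancl_trans)

lemma joined_sym:
  assumes "(u, v) \<in> joined en F"
  shows "(v, u) \<in> joined en F"
proof -
  have "sym {(u, v). \<exists>e\<in>F. en e = {u, v}}"
    by (rule symI) (simp add: insert_commute)
  from symD[OF sym_rtrancl[OF this]] assms show ?thesis
    unfolding joined_def .
qed

lemma joined_class_eq_iff:
  "joined en F `` {x} = joined en F `` {y} \<longleftrightarrow> (x, y) \<in> joined en F"
proof
  assume "joined en F `` {x} = joined en F `` {y}"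
  moreover have "y \<in> joined en F `` {y}" by simp
  ultimately show "(x, y) \<in> joined en F" by blast
next
  assume xy: "(x, y) \<in> joined en F"
  show "joined en F `` {x} = joined en F `` {y}"
    using joined_trans[OF xy] joined_trans[OF joined_sym[OF xy]] by blast
qed

lemma joined_edge: "e \<in> F \<Longrightarrow> en e = {u, v} \<Longrightarrow> (u, v) \<in> joined en F"
  unfolding joined_def by (intro r_into_rtrancl) auto

lemma joined_mono: "F \<subseteq> F' \<Longrightarrow> joined en F \<subseteq> joined en F'"
  unfolding joined_def by (intro rtrancl_mono) auto

lemma joined_minimal:
  assumes "\<And>e u v. e \<in> F \<Longrightarrow> en e = {u, v} \<Longrightarrow> (u, v) \<in> joined en F'"
  shows "joined en F \<subseteq> joined en F'"
proof -
  have "{(u, v). \<exists>e\<in>F. en e = {u, v}} \<subseteq> joined en F'"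
    by (blast intro: assms)
  then show ?thesis
    unfolding joined_def[of en F'] joined_def[of en F] by (rule rtrancl_subset_rtrancl)
qed

lemma joined_insert:
  assumes e: "en e = {u, v}"
  shows "(x, y) \<in> joined en (insert e F) \<longleftrightarrow> (x, y) \<in> joined en F \<or>
     (x, u) \<in> joined en F \<and> (v, y) \<in> joined en F \<or> (x, v) \<in> joined en F \<and> (u, y) \<in> joined en F"
proof -
  define L where "L = {(u, v). \<exists>e\<in>F. en e = {u, v}}"
  have J: "joined en F = L\<^sup>*" by (simp only: joined_def L_def)
  have "{(a, b). \<exists>e\<in>insert e F. en e = {a, b}} = insert (u, v) (insert (v, u) L)"
    using e by (auto simp: L_def doubleton_eq_iff)
  then have "joined en (insert e F) = (insert (u, v) (insert (v, u) L))\<^sup>*"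
    by (simp only: joined_def)
  then show ?thesis
    using rtrancl_trans[of x u L y] rtrancl_trans[of x v L y]
    unfolding J by (simp only: rtrancl_insert Un_iff mem_Collect_eq case_prod_conv) blast
qed

text \<open>If \<open>e\<close> connects the ends of \<open>g\<close> over \<open>F\<close>, then the ends of \<open>e\<close> are joined in \<open>F\<close> to different
  ends of \<open>g\<close>, so \<open>g\<close> connects the ends of \<open>e\<close> in return.\<close>

lemma joined_exchange:
  assumes "en e = {u, v}" "en g = {a, b}"
    and "(a, b) \<in> joined en (insert e F)" "(a, b) \<notin> joined en F"
  shows "(u, v) \<in> joined en (insert g F)"
  using assms(3,4) joined_insert[of en e u v, OF assms(1)] joined_insert[of en g a b, OF assms(2)]
  by (blast intro: joined_sym)

lemma joined_within:
  assumes "(x, y) \<in> joined en F" "x \<in> V"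
    and closed: "\<And>g a b. g \<in> F \<Longrightarrow> en g = {a, b} \<Longrightarrow> a \<in> V \<Longrightarrow> g \<in> E \<and> b \<in> V"
  shows "(x, y) \<in> joined en (F \<inter> E)"
proof -
  have "(x, y) \<in> joined en (F \<inter> E) \<and> y \<in> V"
    using assms(1) unfolding joined_def[of en F]
  proof (induction rule: rtrancl_induct)
    case base
    show ?case using assms(2) by simp
  next
    case (step y z)
    then obtain g where g: "g \<in> F" "en g = {y, z}" by auto
    with closed step.IH have gE: "g \<in> E" "z \<in> V" by blast+
    with g have "(y, z) \<in> joined en (F \<inter> E)" by (intro joined_edge) auto
    with step.IH gE show ?case using joined_trans by fast
  qed
  then show ?thesis ..
qed

lemma forest_subset:
  assumes "forest en F" "F' \<subseteq> F"
  shows "forest en F'"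
  unfolding forest_def
proof (intro ballI allI impI)
  fix e u v assume "e \<in> F'" "en e = {u, v}"
  moreover have "joined en (F' - {e}) \<subseteq> joined en (F - {e})"
    using assms(2) by (intro joined_mono) auto
  ultimately show "(u, v) \<notin> joined en (F' - {e})"
    using assms unfolding forest_def by blast
qed

lemma forest_insert:
  assumes F: "forest en F" and e: "en e = {u, v}" "(u, v) \<notin> joined en F"
  shows "forest en (insert e F)"
  unfolding forest_def
proof (intro ballI allI impI)
  fix g a b assume g: "g \<in> insert e F" "en g = {a, b}"
  show "(a, b) \<notin> joined en (insert e F - {g})"
  proof (cases "g = e")
    case True
    have "joined en (insert e F - {e}) \<subseteq> joined en F" by (intro joined_mono) auto
    moreover have "(a, b) \<notin> joined en F"
      using True e g by (auto simp: doubleton_eq_iff dest: joined_sym)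
    ultimately show ?thesis using True by auto
  next
    case False
    with g have gF: "g \<in> F" by simp
    then have nj: "(a, b) \<notin> joined en (F - {g})"
      using F g(2) by (auto simp: forest_def)
    show ?thesis
    proof
      assume "(a, b) \<in> joined en (insert e F - {g})"
      then have "(a, b) \<in> joined en (insert e (F - {g}))"
        using False by (simp add: insert_Diff_if)
      from joined_exchange[OF e(1) g(2) this nj] have "(u, v) \<in> joined en F"
        using gF by (simp add: insert_absorb)
      with e(2) show False ..
    qed
  qed
qed

text \<open>In a forest the path between two vertices is unique. So the edges whose deletion keeps the ends
  of \<open>e\<close> joined all lie off this path, and can be deleted together. If deleting one more edge \<open>f\<close>
  separated the ends of \<open>e\<close>, then \<open>e\<close> would reconnect the ends of \<open>f\<close>; but \<open>e\<close> can be bypassed in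
  \<open>F - {f}\<close>, so \<open>f\<close> would not be a bridge.\<close>

lemma forest_joined_Diff:
  assumes F: "forest en F" "D \<subseteq> F" and edge_ends: "\<And>f. f \<in> D \<Longrightarrow> \<exists>a b. en f = {a, b}"
    and e: "en e = {u, v}" "(u, v) \<in> joined en F"
    and single: "\<And>f. f \<in> D \<Longrightarrow> (u, v) \<in> joined en (F - {f})" and "finite D"
  shows "(u, v) \<in> joined en (F - D)"
  using \<open>finite D\<close> F(2) edge_ends single
proof (induction D)
  case empty
  show ?case using e by simp
next
  case (insert f D)
  obtain a b where f: "en f = {a, b}" using insert.prems by blast
  have fF: "f \<in> F" and uvf: "(u, v) \<in> joined en (F - {f})" using insert.prems by auto
  have "f \<in> F - D" using fF insert.hyps by auto
  then have "insert f (F - insert f D) = F - D" by auto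
  then have uvD: "(u, v) \<in> joined en (insert f (F - insert f D))"
    using insert by auto
  show ?case
  proof (rule ccontr)
    assume "(u, v) \<notin> joined en (F - insert f D)"
    from joined_exchange[OF f e(1) uvD this]
    have "(a, b) \<in> joined en (insert e (F - {f}))"
      using joined_mono[of "insert e (F - insert f D)" "insert e (F - {f})" en] by auto
    then have "(a, b) \<in> joined en (F - {f})"
      using uvf joined_sym[OF uvf] by (auto simp: joined_insert[of en e u v, OF e(1)] intro: joined_trans)
    then show False using F(1) fF f by (auto simp: forest_def)
  qed
qed

text \<open>Each edge that is added to a forest merges exactly two connectivity classes.\<close>

lemma forest_card_classes:
  assumes "finite F" "forest en F" and "finite V"
    and "\<And>e. e \<in> F \<Longrightarrow> \<exists>u\<in>V. \<exists>v\<in>V. en e = {u, v}"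
  shows "card F + card (V // joined en F) = card V"
  using assms(1,2,4)
proof (induction F)
  case empty
  have "joined en {} = Id" by (simp add: joined_def)
  then have "V // joined en {} = (\<lambda>x. {x}) ` V" by (auto simp: quotient_def)
  then show ?case by (simp add: card_image)
next
  case (insert e F)
  obtain u v where uv: "u \<in> V" "v \<in> V" "en e = {u, v}" using insert.prems by blast
  have "insert e F - {e} = F" using insert.hyps by auto
  then have nj: "(u, v) \<notin> joined en F"
    using insert.prems(1) uv unfolding forest_def by fastforce
  have IH: "card F + card (V // joined en F) = card V"
    using insert forest_subset[of en "insert e F" F] by blast
  define c where "c x = joined en F `` {x}" for x
  have c_eq_iff: "c x = c y \<longleftrightarrow> (x, y) \<in> joined en F" for x y
    by (simp only: c_def joined_class_eq_iff)
  have in_c: "y \<in> c x \<longleftrightarrow> c x = c y" for x y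
    unfolding c_eq_iff by (simp add: c_def)
  have in_Un: "x \<in> c u \<union> c v \<longleftrightarrow> c x = c u \<or> c x = c v" for x
    unfolding Un_iff in_c by metis
  have "joined en (insert e F) `` {x} = (if x \<in> c u \<union> c v then c u \<union> c v else c x)" for x
  proof (rule set_eqI)
    fix y
    have "y \<in> joined en (insert e F) `` {x} \<longleftrightarrow>
        c x = c y \<or> c x = c u \<and> c v = c y \<or> c x = c v \<and> c u = c y"
      by (simp only: Image_singleton_iff joined_insert[of en e u v, OF uv(3)] c_eq_iff)
    also have "\<dots> \<longleftrightarrow> y \<in> (if x \<in> c u \<union> c v then c u \<union> c v else c x)"
      by (simp only: in_Un in_c split: if_split) metis
    finally show "y \<in> joined en (insert e F) `` {x} \<longleftrightarrow>
        y \<in> (if x \<in> c u \<union> c v then c u \<union> c v else c x)" .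
  qed
  then have "V // joined en (insert e F) = (\<lambda>x. if x \<in> c u \<union> c v then c u \<union> c v else c x) ` V"
    by (auto simp: quotient_def)
  also have "\<dots> = insert (c u \<union> c v) (c ` V - {c u, c v})" (is "?A = ?B")
    unfolding in_Un using uv(1) by auto
  finally have new: "V // joined en (insert e F) = ?B" .
  have old: "V // joined en F = c ` V" by (auto simp: quotient_def c_def)
  have "c u \<noteq> c v" using nj by (simp add: c_eq_iff)
  have "c u \<union> c v \<notin> c ` V"
  proof
    assume "c u \<union> c v \<in> c ` V"
    then obtain x where "c u \<union> c v = c x" by auto
    moreover have "u \<in> c u" "v \<in> c v" by (simp_all only: in_c)
    ultimately have "u \<in> c x" "v \<in> c x" by auto
    then have "c x = c u" "c x = c v" by (simp_all only: in_c)
    with \<open>c u \<noteq> c v\<close> show False by simp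
  qed
  moreover have "card (c ` V - {c u, c v}) = card (c ` V) - 2"
    using uv \<open>c u \<noteq> c v\<close> by (subst card_Diff_subset) auto
  moreover have "2 \<le> card (c ` V)"
    using card_mono[of "c ` V" "{c u, c v}"] uv \<open>finite V\<close> \<open>c u \<noteq> c v\<close> by auto
  ultimately have "card (V // joined en (insert e F)) + 1 = card (V // joined en F)"
    unfolding new old using \<open>finite V\<close> by (subst card_insert_disjoint) auto
  with IH insert.hyps show ?case by simp
qed

lemma card_forest_less:
  assumes "finite F" "forest en F" "finite V" "V \<noteq> {}"
    and "\<And>e. e \<in> F \<Longrightarrow> \<exists>u\<in>V. \<exists>v\<in>V. en e = {u, v}"
  shows "card F < card V"
proof -
  have "V // joined en F = (\<lambda>x. joined en F `` {x}) ` V" by (auto simp: quotient_def)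
  with assms(3,4) have "card (V // joined en F) > 0" by (simp add: card_gt_0_iff)
  with forest_card_classes[OF assms(1-3,5)] show ?thesis by simp
qed

lemma card_spanning_forest:
  assumes "finite F" "forest en F" "finite V" "V \<noteq> {}"
    and "\<And>e. e \<in> F \<Longrightarrow> \<exists>u\<in>V. \<exists>v\<in>V. en e = {u, v}"
    and span: "\<And>u v. u \<in> V \<Longrightarrow> v \<in> V \<Longrightarrow> (u, v) \<in> joined en F"
  shows "card F + 1 = card V"
proof -
  obtain x where "x \<in> V" using assms(4) by blast
  have "joined en F `` {y} = joined en F `` {x}" if "y \<in> V" for y
    using span[OF that \<open>x \<in> V\<close>] by (simp only: joined_class_eq_iff)
  then have "V // joined en F = {joined en F `` {x}}"
    using \<open>x \<in> V\<close> unfolding quotient_def by blast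
  with forest_card_classes[OF assms(1-3,5)] show ?thesis by simp
qed

section \<open>Forests and cycles\<close>

lemma joined_imp_simple_path:
  assumes "(u, v) \<in> joined en F"
  obtains vs es where "length vs = Suc (length es)" "distinct vs" "vs ! 0 = u"
    "vs ! length es = v" "set es \<subseteq> F" "\<forall>i<length es. en (es ! i) = {vs ! i, vs ! Suc i}"
proof -
  have "\<exists>vs es. length vs = Suc (length es) \<and> distinct vs \<and> vs ! 0 = u \<and> vs ! length es = v \<and>
      set es \<subseteq> F \<and> (\<forall>i<length es. en (es ! i) = {vs ! i, vs ! Suc i})"
    using assms unfolding joined_def
  proof (induction rule: converse_rtrancl_induct)
    case base
    show ?case by (rule exI[of _ "[v]"], rule exI[of _ "[]"]) simp
  next
    case (step w x)
    then obtain g vs es where g: "g \<in> F" "en g = {w, x}"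
      and p: "length vs = Suc (length es)" "distinct vs" "vs ! 0 = x" "vs ! length es = v"
        "set es \<subseteq> F" "\<And>i. i < length es \<Longrightarrow> en (es ! i) = {vs ! i, vs ! Suc i}"
      by auto
    show ?case
    proof (cases "w \<in> set vs")
      case False
      have "en ((g # es) ! i) = {(w # vs) ! i, (w # vs) ! Suc i}" if "i < length (g # es)" for i
        using that g p by (cases i) auto
      with False g p show ?thesis
        by (intro exI[of _ "w # vs"] exI[of _ "g # es"]) auto
    next
      \<comment> \<open>The path already visits \<open>w\<close>, so its tail from there on is the required path.\<close>
      case True
      then obtain i where i: "i < length vs" "vs ! i = w" by (auto simp: in_set_conv_nth)
      with p show ?thesis
        by (intro exI[of _ "drop i vs"] exI[of _ "drop i es"]) (auto dest: in_set_dropD)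
    qed
  qed
  then show thesis using that by blast
qed

lemma acyclic_iff_forest:
  assumes edge_ends: "\<And>e. e \<in> F \<Longrightarrow> \<exists>u v. ends G e = {u, v}"
  shows "(\<nexists>vs es. is_cycle (G\<lparr>edges := F\<rparr>) vs es) \<longleftrightarrow> forest (ends G) F"
proof
  assume forest: "forest (ends G) F"
  show "\<nexists>vs es. is_cycle (G\<lparr>edges := F\<rparr>) vs es"
  proof
    assume "\<exists>vs es. is_cycle (G\<lparr>edges := F\<rparr>) vs es"
    then obtain vs es where c: "es \<noteq> []" "distinct es" "set es \<subseteq> F"
      "\<And>i. i < length es \<Longrightarrow> ends G (es ! i) = {vs ! i, vs ! (Suc i mod length es)}"
      unfolding is_cycle_def by auto
    define n where "n = length es - 1"
    have n: "length es = Suc n" using c(1) by (simp add: n_def)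
    \<comment> \<open>The other edges of the cycle join the ends of the edge that closes it.\<close>
    have "(vs ! 0, vs ! k) \<in> joined (ends G) (F - {es ! n})" if "k \<le> n" for k
      using that
    proof (induction k)
      case (Suc k)
      then have "es ! k \<noteq> es ! n" using c(2) n by (simp add: nth_eq_iff_index_eq)
      moreover have "es ! k \<in> F" using c(3) n Suc.prems by auto
      ultimately have "(vs ! k, vs ! Suc k) \<in> joined (ends G) (F - {es ! n})"
        using c(4)[of k] n Suc.prems by (intro joined_edge) auto
      with Suc show ?case by (auto intro: joined_trans)
    qed simp
    from joined_sym[OF this[of n]] have "(vs ! n, vs ! 0) \<in> joined (ends G) (F - {es ! n})"
      by simp
    moreover have "es ! n \<in> F" "ends G (es ! n) = {vs ! n, vs ! 0}"
      using c(3) c(4)[of n] n by auto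
    ultimately show False using forest unfolding forest_def by blast
  qed
next
  assume acyclic: "\<nexists>vs es. is_cycle (G\<lparr>edges := F\<rparr>) vs es"
  show "forest (ends G) F"
    unfolding forest_def
  proof (intro ballI allI impI notI)
    fix e u v
    assume e: "e \<in> F" "ends G e = {u, v}" and uv: "(u, v) \<in> joined (ends G) (F - {e})"
    obtain vs es where p: "length vs = Suc (length es)" "distinct vs" "vs ! 0 = u"
      "vs ! length es = v" "set es \<subseteq> F - {e}"
      "\<forall>i<length es. ends G (es ! i) = {vs ! i, vs ! Suc i}"
      using uv by (rule joined_imp_simple_path)
    \<comment> \<open>An edge determines its two ends, and these determine its position on a simple path.\<close>
    have "distinct es"
      unfolding distinct_conv_nth
    proof (intro allI impI notI)
      fix i j assume ij: "i < length es" "j < length es" "i \<noteq> j" "es ! i = es ! j"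
      then have "{vs ! i, vs ! Suc i} = {vs ! j, vs ! Suc j}" using p(6) by metis
      with ij p(1,2) show False by (auto simp: doubleton_eq_iff nth_eq_iff_index_eq)
    qed
    moreover have "ends G ((es @ [e]) ! i) = {vs ! i, vs ! (Suc i mod length (es @ [e]))}"
      if "i < length (es @ [e])" for i
    proof (cases "i = length es")
      case True
      with p(3,4) e(2) show ?thesis by (simp add: insert_commute)
    next
      case False
      with that have "i < length es" by simp
      with p(6) show ?thesis by (simp add: nth_append)
    qed
    ultimately have "is_cycle (G\<lparr>edges := F\<rparr>) vs (es @ [e])"
      using p e by (auto simp: is_cycle_def)
    with acyclic show False by blast
  qed
qed

section \<open>Spanning trees\<close>

lemma loopless_edge_ends:
  assumes "finite_multigraph G" "loopless G" "e \<in> edges G"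
  shows "\<exists>u\<in>verts G. \<exists>v\<in>verts G. u \<noteq> v \<and> ends G e = {u, v}"
proof -
  have "ends G e \<subseteq> verts G" "card (ends G e) = 2"
    using assms by (auto simp: finite_multigraph_def loopless_def)
  then show ?thesis by (auto simp: card_2_iff)
qed

lemma spanning_trees_iff:
  assumes "finite_multigraph G" "loopless G" "verts G \<noteq> {}"
  shows "\<gamma> \<in> spanning_trees G \<longleftrightarrow> \<gamma> \<subseteq> edges G \<and> forest (ends G) \<gamma> \<and>
    (\<forall>u\<in>verts G. \<forall>v\<in>verts G. (u, v) \<in> joined (ends G) \<gamma>)"
proof (cases "\<gamma> \<subseteq> edges G")
  case True
  have "(\<nexists>vs es. is_cycle (G\<lparr>edges := \<gamma>\<rparr>) vs es) \<longleftrightarrow> forest (ends G) \<gamma>"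
    using True loopless_edge_ends[OF assms(1,2)] by (intro acyclic_iff_forest) blast
  with True assms(3) show ?thesis
    by (auto simp: spanning_trees_def is_tree_def connected_graph_iff_joined)
next
  case False
  then show ?thesis by (simp add: spanning_trees_def)
qed

lemma spanning_tree_exchange:
  assumes G: "finite_multigraph G" "loopless G" "verts G \<noteq> {}"
    and \<gamma>: "\<gamma> \<in> spanning_trees G" and f: "f \<in> \<gamma>" and e: "e \<in> edges G" "ends G e = {u, v}"
    and cut: "(u, v) \<notin> joined (ends G) (\<gamma> - {f})"
  shows "insert e (\<gamma> - {f}) \<in> spanning_trees G"
proof -
  note tree = \<gamma>[unfolded spanning_trees_iff[OF G]]
  have "ends G e \<subseteq> verts G" using G(1) e(1) by (simp add: finite_multigraph_def)
  then have uv: "(u, v) \<in> joined (ends G) \<gamma>" using tree e(2) by simp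
  have "forest (ends G) (insert e (\<gamma> - {f}))"
    using tree cut e(2) forest_subset[of "ends G" \<gamma> "\<gamma> - {f}"] by (intro forest_insert) auto
  moreover have "joined (ends G) \<gamma> \<subseteq> joined (ends G) (insert e (\<gamma> - {f}))"
  proof (rule joined_minimal)
    fix g x y assume g: "g \<in> \<gamma>" "ends G g = {x, y}"
    show "(x, y) \<in> joined (ends G) (insert e (\<gamma> - {f}))"
    proof (cases "g = f")
      case True
      have "(u, v) \<in> joined (ends G) (insert f (\<gamma> - {f}))"
        using uv f by (simp add: insert_absorb)
      from joined_exchange[OF _ e(2) this cut] True g(2) show ?thesis by simp
    next
      case False
      with g show ?thesis by (intro joined_edge) auto
    qed
  qed
  ultimately show ?thesis
    using tree e(1) unfolding spanning_trees_iff[OF G] by blast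
qed

section \<open>Edge usage and overlap\<close>

lemma finite_spanning_trees: "finite (edges G) \<Longrightarrow> finite (spanning_trees G)"
  by (rule finite_subset[of _ "Pow (edges G)"]) (auto simp: spanning_trees_def)

lemma edge_usage_eq_sum:
  assumes "finite (edges G)"
  shows "edge_usage G \<mu> e = (\<Sum>\<gamma>\<in>spanning_trees G. of_bool (e \<in> \<gamma>) * pmf \<mu> \<gamma>)"
proof -
  have "edge_usage G \<mu> e = (\<Sum>\<gamma>\<in>spanning_trees G. if e \<in> \<gamma> then pmf \<mu> \<gamma> else 0)"
    using finite_spanning_trees[OF assms]
    by (simp add: edge_usage_def sum.inter_filter)
  also have "\<dots> = (\<Sum>\<gamma>\<in>spanning_trees G. of_bool (e \<in> \<gamma>) * pmf \<mu> \<gamma>)"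
    by (intro sum.cong) auto
  finally show ?thesis .
qed

lemma card_Int_eq_sum: "finite F \<Longrightarrow> real (card (\<gamma> \<inter> F)) = (\<Sum>e\<in>F. of_bool (e \<in> \<gamma>))"
  by (simp add: Int_commute Int_def)

lemma sum_edge_usage:
  assumes "finite (edges G)" "F \<subseteq> edges G"
  shows "(\<Sum>e\<in>F. edge_usage G \<mu> e) = (\<Sum>\<gamma>\<in>spanning_trees G. real (card (\<gamma> \<inter> F)) * pmf \<mu> \<gamma>)"
proof -
  have "finite F" using assms finite_subset by blast
  have "(\<Sum>e\<in>F. edge_usage G \<mu> e) =
      (\<Sum>\<gamma>\<in>spanning_trees G. \<Sum>e\<in>F. of_bool (e \<in> \<gamma>) * pmf \<mu> \<gamma>)"
    unfolding edge_usage_eq_sum[OF assms(1)] by (rule sum.swap)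
  then show ?thesis
    by (simp only: card_Int_eq_sum[OF \<open>finite F\<close>] sum_distrib_right)
qed

lemma expected_overlap_eq_sum_squares:
  assumes "finite (edges G)"
  shows "expected_overlap G \<mu> = (\<Sum>e\<in>edges G. (edge_usage G \<mu> e)\<^sup>2)"
proof -
  let ?T = "spanning_trees G"
  have "(\<Sum>e\<in>edges G. (edge_usage G \<mu> e)\<^sup>2) = (\<Sum>e\<in>edges G. \<Sum>\<gamma>\<in>?T. \<Sum>\<gamma>'\<in>?T.
      (of_bool (e \<in> \<gamma>) * pmf \<mu> \<gamma>) * (of_bool (e \<in> \<gamma>') * pmf \<mu> \<gamma>'))"
    by (simp only: edge_usage_eq_sum[OF assms] power2_eq_square sum_product)
  also have "\<dots> = (\<Sum>\<gamma>\<in>?T. \<Sum>\<gamma>'\<in>?T. \<Sum>e\<in>edges G.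
      (of_bool (e \<in> \<gamma>) * pmf \<mu> \<gamma>) * (of_bool (e \<in> \<gamma>') * pmf \<mu> \<gamma>'))"
    by (subst sum.swap, intro sum.cong refl, rule sum.swap)
  also have "\<dots> = expected_overlap G \<mu>"
    unfolding expected_overlap_def
  proof (intro sum.cong refl)
    fix \<gamma> \<gamma>' assume "\<gamma> \<in> ?T" "\<gamma>' \<in> ?T"
    then have "\<gamma> \<inter> \<gamma>' \<inter> edges G = \<gamma> \<inter> \<gamma>'" by (auto simp: spanning_trees_def)
    then have "real (card (\<gamma> \<inter> \<gamma>')) = (\<Sum>e\<in>edges G. of_bool (e \<in> \<gamma> \<inter> \<gamma>'))"
      using card_Int_eq_sum[OF assms, of "\<gamma> \<inter> \<gamma>'"] by simp
    then show "(\<Sum>e\<in>edges G. (of_bool (e \<in> \<gamma>) * pmf \<mu> \<gamma>) * (of_bool (e \<in> \<gamma>') * pmf \<mu> \<gamma>')) =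
        real (card (\<gamma> \<inter> \<gamma>')) * pmf \<mu> \<gamma> * pmf \<mu> \<gamma>'"
      by (simp only: sum_distrib_right) (intro sum.cong, auto)
  qed
  finally show ?thesis by simp
qed

lemma edge_usage_nonneg: "0 \<le> edge_usage G \<mu> e"
  unfolding edge_usage_def by (intro sum_nonneg) simp

lemma edge_usage_zero:
  assumes "\<And>\<gamma>. \<gamma> \<in> set_pmf \<mu> \<Longrightarrow> e \<notin> \<gamma>"
  shows "edge_usage G \<mu> e = 0"
  unfolding edge_usage_def using assms by (intro sum.neutral) (auto simp: set_pmf_eq)

lemma sum_tree_pmf:
  assumes "finite (edges G)" "\<mu> \<in> tree_pmfs G"
  shows "(\<Sum>\<gamma>\<in>spanning_trees G. pmf \<mu> \<gamma>) = 1"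
  using assms finite_spanning_trees by (intro sum_pmf_eq_1) (auto simp: tree_pmfs_def)

section \<open>First-order optimality\<close>

lemma move_tree_mass:
  assumes fin: "finite (edges G)" and \<mu>: "\<mu> \<in> tree_pmfs G"
    and T: "\<gamma> \<in> spanning_trees G" "\<gamma>' \<in> spanning_trees G" and t: "0 \<le> t" "t \<le> pmf \<mu> \<gamma>"
  obtains \<nu> where "\<nu> \<in> tree_pmfs G"
    "\<And>e. edge_usage G \<nu> e = edge_usage G \<mu> e + t * (of_bool (e \<in> \<gamma>') - of_bool (e \<in> \<gamma>))"
proof -
  let ?T = "spanning_trees G"
  define p where "p x = pmf \<mu> x + t * (of_bool (x = \<gamma>') - of_bool (x = \<gamma>))" for x
  have nonneg: "0 \<le> p x" for x
    using t by (auto simp: p_def)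
  have outside: "p x = 0" if "x \<notin> ?T" for x
    using that T \<mu> by (auto simp: p_def tree_pmfs_def set_pmf_eq)
  have finT: "finite ?T" using fin by (rule finite_spanning_trees)
  \<comment> \<open>Both the total mass and the edge usage are linear functionals of \<open>p\<close>.\<close>
  have linear: "(\<Sum>x\<in>?T. w x * p x) = (\<Sum>x\<in>?T. w x * pmf \<mu> x) + t * (w \<gamma>' - w \<gamma>)"
    for w :: "_ set \<Rightarrow> real"
  proof -
    have "(\<Sum>x\<in>?T. w x * p x) = (\<Sum>x\<in>?T. w x * pmf \<mu> x) +
        (\<Sum>x\<in>?T. (if x = \<gamma>' then t * w x else 0) - (if x = \<gamma> then t * w x else 0))"
      unfolding sum.distrib[symmetric] by (intro sum.cong) (auto simp: p_def algebra_simps)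
    also have "(\<Sum>x\<in>?T. (if x = \<gamma>' then t * w x else 0) - (if x = \<gamma> then t * w x else 0)) =
        t * (w \<gamma>' - w \<gamma>)"
      using T finT by (simp add: sum_subtractf algebra_simps)
    finally show ?thesis .
  qed
  have "(\<Sum>x\<in>?T. p x) = 1"
    using linear[of "\<lambda>_. 1"] sum_tree_pmf[OF fin \<mu>] by simp
  moreover have "(\<integral>\<^sup>+x. ennreal (p x) \<partial>count_space UNIV) = (\<Sum>x\<in>?T. ennreal (p x))"
    using finT outside by (intro nn_integral_count_space') auto
  ultimately have total: "(\<integral>\<^sup>+x. ennreal (p x) \<partial>count_space UNIV) = 1"
    using nonneg by (simp add: sum_ennreal)
  have \<nu>: "pmf (embed_pmf p) x = p x" for x
    by (rule pmf_embed_pmf[OF nonneg total])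
  show thesis
  proof (rule that)
    show "embed_pmf p \<in> tree_pmfs G"
      using outside \<nu> by (auto simp: tree_pmfs_def set_pmf_eq)
    show "edge_usage G (embed_pmf p) e =
        edge_usage G \<mu> e + t * (of_bool (e \<in> \<gamma>') - of_bool (e \<in> \<gamma>))" for e
      unfolding edge_usage_eq_sum[OF fin] \<nu> by (rule linear)
  qed
qed

text \<open>Moving mass \<open>t\<close> along the exchange changes the sum of squares by
  \<open>2 t (\<eta> e - \<eta> f) + 2 t\<^sup>2\<close>, which is negative for \<open>0 < t < \<eta> f - \<eta> e\<close>.\<close>

lemma optimal_pmf_no_improving_exchange:
  assumes fin: "finite (edges G)" and opt: "optimal_pmf G \<mu>" and \<gamma>: "\<gamma> \<in> set_pmf \<mu>"
    and f: "f \<in> \<gamma>" and e: "e \<in> edges G" "e \<notin> \<gamma>"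
    and tree: "insert e (\<gamma> - {f}) \<in> spanning_trees G"
  shows "edge_usage G \<mu> f \<le> edge_usage G \<mu> e"
proof (rule ccontr)
  assume "\<not> edge_usage G \<mu> f \<le> edge_usage G \<mu> e"
  let ?\<eta> = "edge_usage G \<mu>"
  define d where "d = ?\<eta> f - ?\<eta> e"
  have d: "0 < d" using \<open>\<not> ?\<eta> f \<le> ?\<eta> e\<close> by (simp add: d_def)
  have \<mu>: "\<mu> \<in> tree_pmfs G" using opt by (simp add: optimal_pmf_def)
  have \<gamma>T: "\<gamma> \<in> spanning_trees G" using \<mu> \<gamma> by (auto simp: tree_pmfs_def)
  have fG: "f \<in> edges G" using f \<gamma>T by (auto simp: spanning_trees_def)
  have ef: "e \<noteq> f" using f e by auto
  define t where "t = min (pmf \<mu> \<gamma>) (d / 2)"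
  have t: "0 < t" "t \<le> pmf \<mu> \<gamma>" "t < d"
    using d \<gamma> by (auto simp: t_def pmf_positive)
  obtain \<nu> where \<nu>: "\<nu> \<in> tree_pmfs G"
    "\<And>g. edge_usage G \<nu> g = ?\<eta> g + t * (of_bool (g \<in> insert e (\<gamma> - {f})) - of_bool (g \<in> \<gamma>))"
    using move_tree_mass[OF fin \<mu> \<gamma>T tree less_imp_le[OF t(1)] t(2)] by blast
  have usage: "edge_usage G \<nu> e = ?\<eta> e + t" "edge_usage G \<nu> f = ?\<eta> f - t"
    "\<And>g. g \<in> edges G - {e, f} \<Longrightarrow> edge_usage G \<nu> g = ?\<eta> g"
    using f e ef by (auto simp: \<nu>(2))
  have split: "(\<Sum>g\<in>edges G. h g) = (\<Sum>g\<in>edges G - {e, f}. h g) + h e + h f"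
    for h :: "_ \<Rightarrow> real"
    using sum.subset_diff[of "{e, f}" "edges G" h] fin fG e ef by simp
  have "expected_overlap G \<nu> = expected_overlap G \<mu> + 2 * (t * (t - d))"
    unfolding expected_overlap_eq_sum_squares[OF fin] split usage d_def
    using usage(3) by (simp add: power2_eq_square algebra_simps)
  moreover have "t * (t - d) < 0" using t by (simp add: mult_pos_neg)
  ultimately show False using opt \<nu>(1) unfolding optimal_pmf_def by force
qed

text \<open>Otherwise the path in \<open>\<gamma>\<close> between the ends of \<open>e\<close> would contain an edge \<open>f\<close> of larger usage,
  and exchanging \<open>f\<close> for \<open>e\<close> would improve the pmf.\<close>

lemma support_tree_joins_min_usage_edge:
  assumes G: "finite_multigraph G" "loopless G" "verts G \<noteq> {}" and opt: "optimal_pmf G \<mu>"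
    and \<gamma>: "\<gamma> \<in> set_pmf \<mu>" and e: "e \<in> min_usage_edges G \<mu>" "ends G e = {u, v}"
  shows "(u, v) \<in> joined (ends G) (\<gamma> \<inter> min_usage_edges G \<mu>)"
proof (rule ccontr)
  let ?M = "min_usage_edges G \<mu>"
  assume nj: "(u, v) \<notin> joined (ends G) (\<gamma> \<inter> ?M)"
  have fin: "finite (edges G)" using G(1) by (simp add: finite_multigraph_def)
  have \<gamma>T: "\<gamma> \<in> spanning_trees G"
    using opt \<gamma> by (auto simp: optimal_pmf_def tree_pmfs_def)
  note tree = \<gamma>T[unfolded spanning_trees_iff[OF G]]
  have eG: "e \<in> edges G" using e by (simp add: min_usage_edges_def)
  then have uv: "u \<in> verts G" "v \<in> verts G"
    using e(2) G(1) by (auto simp: finite_multigraph_def)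
  have "e \<notin> \<gamma>" using nj e joined_edge[of e "\<gamma> \<inter> ?M" "ends G" u v] by auto
  have "\<exists>f\<in>\<gamma> - ?M. (u, v) \<notin> joined (ends G) (\<gamma> - {f})"
  proof (rule ccontr)
    assume no_cut: "\<not> ?thesis"
    have "(u, v) \<in> joined (ends G) (\<gamma> - (\<gamma> - ?M))"
    proof (rule forest_joined_Diff[where e = e])
      show "forest (ends G) \<gamma>" using tree by simp
      show "\<exists>a b. ends G f = {a, b}" if "f \<in> \<gamma> - ?M" for f
        using loopless_edge_ends[OF G(1,2), of f] that tree by blast
      show "(u, v) \<in> joined (ends G) \<gamma>" using tree uv by blast
      show "(u, v) \<in> joined (ends G) (\<gamma> - {f})" if "f \<in> \<gamma> - ?M" for f
        using no_cut that by blast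
      show "finite (\<gamma> - ?M)" using tree fin finite_subset by blast
    qed (use e(2) in auto)
    with nj show False by (simp add: Diff_Diff_Int)
  qed
  then obtain f where f: "f \<in> \<gamma> - ?M" "(u, v) \<notin> joined (ends G) (\<gamma> - {f})" by blast
  have "edge_usage G \<mu> f \<le> edge_usage G \<mu> e"
    using f \<open>e \<notin> \<gamma>\<close> spanning_tree_exchange[OF G \<gamma>T _ eG e(2)]
    by (intro optimal_pmf_no_improving_exchange[OF fin opt \<gamma> _ eG]) auto
  moreover have "f \<in> edges G" using f tree by auto
  moreover have "edge_usage G \<mu> e = Min (edge_usage G \<mu> ` edges G)"
    using e by (simp add: min_usage_edges_def)
  ultimately have "f \<in> ?M"
    using fin by (auto simp: min_usage_edges_def intro!: antisym)
  with f show False by simp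
qed

section \<open>Components of minimum usage\<close>

text \<open>A component cannot be enlarged by an edge at one of its vertices.\<close>

lemma component_absorbs_edge:
  assumes comp: "connected_component_of_graph H G"
    and g: "g \<in> edges G" "ends G g = {x, y}" "x \<in> verts H" "y \<in> verts G"
  shows "g \<in> edges H"
proof -
  let ?H = "H\<lparr>verts := insert y (verts H), edges := insert g (edges H)\<rparr>"
  have H: "subgraph H G" "connected_graph H"
    using comp by (auto simp: connected_component_of_graph_def)
  have en: "ends H = ends G" using H by (simp add: subgraph_def)
  have "(w, x) \<in> joined (ends H) (insert g (edges H))" if "w \<in> insert y (verts H)" for w
  proof (cases "w \<in> verts H")
    case True
    then show ?thesis
      using H(2) g(3) joined_mono[of "edges H" "insert g (edges H)" "ends H"]
      by (auto simp: connected_graph_iff_joined)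
  next
    case False
    with that g(2) show ?thesis
      by (intro joined_edge[of g]) (auto simp: en insert_commute)
  qed
  then have "connected_graph ?H"
    by (auto simp: connected_graph_iff_joined intro: joined_trans joined_sym)
  moreover have "subgraph ?H G" "subgraph H ?H"
    using H(1) g by (auto simp: subgraph_def; blast)+
  ultimately have "?H = H"
    using comp unfolding connected_component_of_graph_def by blast
  then have "edges ?H = edges H" by (rule arg_cong)
  then show ?thesis by auto
qed

lemma component_has_edge:
  assumes "connected_component_of_graph H (edge_induced G F)"
    and "\<And>e. e \<in> F \<Longrightarrow> \<exists>u v. ends G e = {u, v}"
  shows "edges H \<noteq> {}"
proof -
  have "verts H \<subseteq> (\<Union>e\<in>F. ends G e)" "verts H \<noteq> {}"
    using assms(1)
    by (simp_all add: connected_component_of_graph_def connected_graph_def subgraph_def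
        edge_induced_def)
  then obtain x e where x: "x \<in> verts H" "e \<in> F" "x \<in> ends G e"
    by blast
  obtain y where y: "ends G e = {x, y}"
    using x(3) assms(2)[OF x(2)] by (metis insertE insert_commute singletonD)
  have "e \<in> edges H"
    using x y by (intro component_absorbs_edge[OF assms(1), of e x y]) (auto simp: edge_induced_def)
  then show ?thesis by auto
qed

text \<open>A tree of the support joins the ends of each edge of \<open>H\<close> by edges of minimum usage, and a walk
  along such edges that starts in the component \<open>H\<close> stays in \<open>H\<close>.\<close>

lemma support_tree_spans_component:
  assumes G: "finite_multigraph G" "loopless G" "verts G \<noteq> {}" and opt: "optimal_pmf G \<mu>"
    and comp: "connected_component_of_graph H (edge_induced G (min_usage_edges G \<mu>))"
    and \<gamma>: "\<gamma> \<in> set_pmf \<mu>" and uv: "u \<in> verts H" "v \<in> verts H"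
  shows "(u, v) \<in> joined (ends G) (\<gamma> \<inter> edges H)"
proof -
  let ?M = "min_usage_edges G \<mu>"
  have H: "subgraph H (edge_induced G ?M)" "connected_graph H"
    using comp by (auto simp: connected_component_of_graph_def)
  then have EH: "edges H \<subseteq> ?M" "ends H = ends G" "\<And>g. g \<in> edges H \<Longrightarrow> ends G g \<subseteq> verts H"
    by (auto simp: subgraph_def edge_induced_def, blast)
  have "(u, v) \<in> joined (ends G) (edges H)"
    using H(2) uv EH(2) by (simp add: connected_graph_iff_joined)
  moreover have "joined (ends G) (edges H) \<subseteq> joined (ends G) (\<gamma> \<inter> ?M)"
    using EH(1) support_tree_joins_min_usage_edge[OF G opt \<gamma>] by (intro joined_minimal) auto
  ultimately have "(u, v) \<in> joined (ends G) (\<gamma> \<inter> ?M)" by blast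
  then have "(u, v) \<in> joined (ends G) (\<gamma> \<inter> ?M \<inter> edges H)"
    using uv(1)
  proof (rule joined_within)
    fix g a b assume g: "g \<in> \<gamma> \<inter> ?M" "ends G g = {a, b}" "a \<in> verts H"
    then have "g \<in> edges H"
      by (intro component_absorbs_edge[OF comp, of g a b]) (auto simp: edge_induced_def)
    with EH(3) g show "g \<in> edges H \<and> b \<in> verts H" by auto
  qed
  then show ?thesis using joined_mono[of "\<gamma> \<inter> ?M \<inter> edges H" "\<gamma> \<inter> edges H"] by blast
qed

lemma min_usage_component_vertex_induced:
  assumes G: "finite_multigraph G" "loopless G" "verts G \<noteq> {}" and opt: "optimal_pmf G \<mu>"
    and comp: "connected_component_of_graph H (edge_induced G (min_usage_edges G \<mu>))"
  shows "vertex_induced H G"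
proof -
  let ?M = "min_usage_edges G \<mu>"
  have "subgraph H (edge_induced G ?M)"
    using comp by (simp add: connected_component_of_graph_def)
  moreover have "(\<Union>e\<in>?M. ends G e) \<subseteq> verts G" "?M \<subseteq> edges G"
    using G(1) by (auto simp: min_usage_edges_def finite_multigraph_def)
  ultimately have sub: "subgraph H G"
    unfolding subgraph_def edge_induced_def by (auto, blast)
  have "e \<in> edges H" if e: "e \<in> edges G" "ends G e \<subseteq> verts H" for e
  proof (rule ccontr)
    assume eH: "e \<notin> edges H"
    obtain u v where uv: "ends G e = {u, v}" using loopless_edge_ends[OF G(1,2) e(1)] by blast
    have "e \<notin> \<gamma>" if \<gamma>: "\<gamma> \<in> set_pmf \<mu>" for \<gamma>
    proof
      assume "e \<in> \<gamma>"
      have "\<gamma> \<in> spanning_trees G"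
        using opt \<gamma> by (auto simp: optimal_pmf_def tree_pmfs_def)
      then have "(u, v) \<notin> joined (ends G) (\<gamma> - {e})"
        using \<open>e \<in> \<gamma>\<close> uv by (auto simp: spanning_trees_iff[OF G] forest_def)
      moreover have "joined (ends G) (\<gamma> \<inter> edges H) \<subseteq> joined (ends G) (\<gamma> - {e})"
        using eH by (intro joined_mono) auto
      ultimately show False
        using support_tree_spans_component[OF G opt comp \<gamma>, of u v] e(2) uv by auto
    qed
    then have zero: "edge_usage G \<mu> e = 0" by (rule edge_usage_zero)
    have "Min (edge_usage G \<mu> ` edges G) = 0"
      using G(1) e(1) zero edge_usage_nonneg[of G \<mu>]
      by (intro Min_eqI) (auto simp: finite_multigraph_def image_iff intro: bexI[of _ e])
    then have "e \<in> ?M" using e(1) zero by (simp add: min_usage_edges_def)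
    then have "e \<in> edges H"
      using uv e(2) by (intro component_absorbs_edge[OF comp, of e u v]) (auto simp: edge_induced_def)
    with eH show False ..
  qed
  with sub show ?thesis by (simp add: vertex_induced_def)
qed

section \<open>Denseness\<close>

lemma subgraph_edge_ends:
  assumes "finite_multigraph G" "loopless G" "subgraph H G" "e \<in> edges H"
  shows "\<exists>u\<in>verts H. \<exists>v\<in>verts H. u \<noteq> v \<and> ends G e = {u, v}"
proof -
  have e: "e \<in> edges G" "ends G e \<subseteq> verts H"
    using assms(3,4) by (auto simp: subgraph_def, blast)
  obtain u v where "u \<noteq> v" "ends G e = {u, v}"
    using loopless_edge_ends[OF assms(1,2) e(1)] by blast
  with e(2) show ?thesis by (intro bexI[of _ u] bexI[of _ v]) auto
qed

lemma subgraph_edge_imp_card_verts: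
  assumes "finite_multigraph G" "loopless G" "subgraph H G" "edges H \<noteq> {}"
  shows "2 \<le> card (verts H)"
proof -
  obtain e where e: "e \<in> edges H" using assms(4) by blast
  obtain u v where "u \<in> verts H" "v \<in> verts H" "u \<noteq> v"
    using subgraph_edge_ends[OF assms(1-3) e] by blast
  moreover have "finite (verts H)"
    using assms(1,3) by (auto simp: finite_multigraph_def subgraph_def intro: finite_subset)
  ultimately show ?thesis using card_mono[of "verts H" "{u, v}"] by simp
qed

lemma sum_usage_subgraph_le:
  assumes G: "finite_multigraph G" "loopless G" and \<mu>: "\<mu> \<in> tree_pmfs G"
    and H: "subgraph H G" "verts H \<noteq> {}"
  shows "(\<Sum>e\<in>edges H. edge_usage G \<mu> e) \<le> real (card (verts H)) - 1"
proof -
  have fin: "finite (edges G)" "finite (verts H)" and EH: "edges H \<subseteq> edges G" "verts G \<noteq> {}"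
    using G(1) H by (auto simp: finite_multigraph_def subgraph_def intro: finite_subset)
  have "real (card (\<gamma> \<inter> edges H)) \<le> real (card (verts H)) - 1" if "\<gamma> \<in> spanning_trees G" for \<gamma>
  proof -
    have "forest (ends G) (\<gamma> \<inter> edges H)"
      using that spanning_trees_iff[OF G EH(2)] forest_subset[of "ends G" \<gamma>] by auto
    then have "card (\<gamma> \<inter> edges H) < card (verts H)"
    proof (rule card_forest_less[rotated])
      show "\<exists>u\<in>verts H. \<exists>v\<in>verts H. ends G e = {u, v}" if "e \<in> \<gamma> \<inter> edges H" for e
        using subgraph_edge_ends[OF G H(1), of e] that by blast
    qed (use fin H(2) finite_subset[OF EH(1) fin(1)] in simp_all)
    then show ?thesis by linarith
  qed
  then have "(\<Sum>e\<in>edges H. edge_usage G \<mu> e) \<le>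
      (\<Sum>\<gamma>\<in>spanning_trees G. (real (card (verts H)) - 1) * pmf \<mu> \<gamma>)"
    unfolding sum_edge_usage[OF fin(1) EH(1)] by (intro sum_mono mult_right_mono) auto
  also have "\<dots> = real (card (verts H)) - 1"
    unfolding sum_distrib_left[symmetric] sum_tree_pmf[OF fin(1) \<mu>] by simp
  finally show ?thesis .
qed

lemma sum_usage_min_component:
  assumes G: "finite_multigraph G" "loopless G" "verts G \<noteq> {}" and opt: "optimal_pmf G \<mu>"
    and comp: "connected_component_of_graph H (edge_induced G (min_usage_edges G \<mu>))"
  shows "(\<Sum>e\<in>edges H. edge_usage G \<mu> e) = real (card (verts H)) - 1"
proof -
  have \<mu>: "\<mu> \<in> tree_pmfs G" using opt by (simp add: optimal_pmf_def)
  have H: "subgraph H G" "verts H \<noteq> {}"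
    using min_usage_component_vertex_induced[OF G opt comp] comp
    by (auto simp: vertex_induced_def connected_component_of_graph_def connected_graph_def)
  have fin: "finite (edges G)" "finite (verts H)" and EH: "edges H \<subseteq> edges G"
    using G(1) H by (auto simp: finite_multigraph_def subgraph_def intro: finite_subset)
  have "real (card (\<gamma> \<inter> edges H)) = real (card (verts H)) - 1" if \<gamma>: "\<gamma> \<in> set_pmf \<mu>" for \<gamma>
  proof -
    have "\<gamma> \<in> spanning_trees G" using \<mu> \<gamma> by (auto simp: tree_pmfs_def)
    then have "forest (ends G) (\<gamma> \<inter> edges H)"
      using spanning_trees_iff[OF G] forest_subset[of "ends G" \<gamma>] by auto
    then have "card (\<gamma> \<inter> edges H) + 1 = card (verts H)"
    proof (rule card_spanning_forest[rotated])
      show "\<exists>u\<in>verts H. \<exists>v\<in>verts H. ends G e = {u, v}" if "e \<in> \<gamma> \<inter> edges H" for e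
        using subgraph_edge_ends[OF G(1,2) H(1), of e] that by blast
      show "(u, v) \<in> joined (ends G) (\<gamma> \<inter> edges H)" if "u \<in> verts H" "v \<in> verts H" for u v
        using support_tree_spans_component[OF G opt comp \<gamma> that] .
    qed (use fin H(2) finite_subset[OF EH fin(1)] in simp_all)
    then show ?thesis by linarith
  qed
  then have "real (card (\<gamma> \<inter> edges H)) * pmf \<mu> \<gamma> = (real (card (verts H)) - 1) * pmf \<mu> \<gamma>" for \<gamma>
    by (cases "\<gamma> \<in> set_pmf \<mu>") (auto simp: set_pmf_iff)
  then have "(\<Sum>e\<in>edges H. edge_usage G \<mu> e) =
      (\<Sum>\<gamma>\<in>spanning_trees G. (real (card (verts H)) - 1) * pmf \<mu> \<gamma>)"
    unfolding sum_edge_usage[OF fin(1) EH] by (intro sum.cong refl)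
  then show ?thesis
    unfolding sum_distrib_left[symmetric] sum_tree_pmf[OF fin(1) \<mu>] by simp
qed

theorem corollary5p10:
  fixes G H :: "('v, 'e) multigraph" and \<mu> :: "'e set pmf"
  assumes "finite_multigraph G" and "loopless G" and "connected_graph G" and "edges G \<noteq> {}"
    and "optimal_pmf G \<mu>"
    and "connected_component_of_graph H (edge_induced G (min_usage_edges G \<mu>))"
  shows "H \<in> densest_candidates G \<and> denseness H = (MAX H'\<in>densest_candidates G. denseness H')"
proof -
  note opt = assms(5) and comp = assms(6)
  have G: "finite_multigraph G" "loopless G" "verts G \<noteq> {}"
    using assms(1-3) by (auto simp: connected_graph_def)
  have \<mu>: "\<mu> \<in> tree_pmfs G" using opt by (simp add: optimal_pmf_def)
  have fin: "finite (edges G)" using G(1) by (simp add: finite_multigraph_def)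
  define m where "m = Min (edge_usage G \<mu> ` edges G)"
  have edge_ends: "\<exists>u v. ends G e = {u, v}" if "e \<in> min_usage_edges G \<mu>" for e
    using that loopless_edge_ends[OF G(1,2), of e] unfolding min_usage_edges_def by blast
  have cand: "H \<in> densest_candidates G"
    using min_usage_component_vertex_induced[OF G opt comp]
      component_has_edge[OF comp edge_ends] comp
    by (auto simp: densest_candidates_def connected_component_of_graph_def)
  have cards: "0 < real (card (edges K))" "0 < real (card (verts K)) - 1"
    if "K \<in> densest_candidates G" for K
  proof -
    have K: "subgraph K G" "edges K \<noteq> {}"
      using that by (auto simp: densest_candidates_def vertex_induced_def)
    then have "finite (edges K)" using fin by (auto simp: subgraph_def intro: finite_subset)
    with K show "0 < real (card (edges K))" by (simp add: card_gt_0_iff)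
    show "0 < real (card (verts K)) - 1"
      using subgraph_edge_imp_card_verts[OF G(1,2) K] by simp
  qed
  have "edges H \<subseteq> min_usage_edges G \<mu>"
    using comp by (auto simp: connected_component_of_graph_def subgraph_def edge_induced_def)
  then have "(\<Sum>e\<in>edges H. edge_usage G \<mu> e) = (\<Sum>e\<in>edges H. m)"
    by (intro sum.cong) (auto simp: min_usage_edges_def m_def)
  then have mH: "m * real (card (edges H)) = real (card (verts H)) - 1"
    using sum_usage_min_component[OF G opt comp] by (simp add: mult.commute)
  with cards[OF cand] have m: "0 < m" by (metis zero_less_mult_pos2)
  have le: "denseness K \<le> denseness H" if K: "K \<in> densest_candidates G" for K
  proof -
    have sub: "subgraph K G" "verts K \<noteq> {}"
      using K by (auto simp: densest_candidates_def vertex_induced_def connected_graph_def)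
    have "(\<Sum>e\<in>edges K. m) \<le> (\<Sum>e\<in>edges K. edge_usage G \<mu> e)"
      using sub(1) fin by (intro sum_mono) (auto simp: m_def subgraph_def)
    also have "\<dots> \<le> real (card (verts K)) - 1"
      by (rule sum_usage_subgraph_le[OF G(1,2) \<mu> sub])
    finally have "m * real (card (edges K)) \<le> real (card (verts K)) - 1"
      by (simp add: mult.commute)
    then have "denseness K \<le> 1 / m"
      using m cards[OF K] by (simp add: denseness_def field_simps)
    also have "1 / m = denseness H"
      using m cards[OF cand] mH by (simp add: denseness_def field_simps)
    finally show ?thesis .
  qed
  have "(MAX H'\<in>densest_candidates G. denseness H') = denseness H"
    using finite_densest_candidates[OF G(1)] cand le by (intro Max_eqI) auto
  with cand show ?thesis by simp
qed

end
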